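(* The lower rank of the semigroup $A^+(B_2)$ is $r_2(A^+(B_2)) = 4$.
   Context: Brandt semigroup. For $n\ge 1$ let $[n]=\{1,\dots,n\}$ and $B_n = ([n]\times[n])\cup\{\vartheta\}$, with the (non-commutative) operation $+$ given by $(i,j)+(k,l)=(i,l)$ if $j=k$ and $(i,j)+(k,l)=\vartheta$ otherwise, and $\vartheta+x=x+\vartheta=\vartheta$ for all $x\in B_n$. Affine maps. Arguments of functions are written on the left ($xf$ is the value of $f$ at $x$), so $x(fg)=(xf)g$. Let $M(B_n)$ be the set of all maps $B_n\to B_n$, with pointwise addition $+$ and composition. A map is affine if it equals $g+h$ with $g$ an endomorphism of $(B_n,+)$ and $h$ a constant map; $\mathrm{Aff}(B_n)$ is the set of affine maps. $A^+(B_n)$ is the smallest subset of $M(B_n)$ containing $\mathrm{Aff}(B_n)$ and closed under $+$ and composition; here it is regarded as a semigroup under composition only. Explicit description (known). For $c\in B_n$ let $\xi_c$ be the constant map with value $c$; for $k,l,p,q\in[n]$ let ${}^{(k,l)}\zeta_{(p,q)}$ be the map sending $(k,l)$ to $(p,q)$ and all other elements to $\vartheta$; for $p,q\in[n]$ and a permutation $\sigma\in S_n$ let $(p,q;\sigma)$ be the map sending $(i,p)$ to $(i\sigma,q)$ for all $i\in[n]$ and all other elements to $\vartheta$. For $n\ge 2$, $A^+(B_n)=\{(p,q;\sigma): p,q\in[n],\sigma\in S_n\}\cup\{\xi_c : c\in B_n\}\cup\{{}^{(k,l)}\zeta_{(p,q)}: k,l,p,q\in[n]\}$. Rank. For a finite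 semigroup $\Gamma$, the lower rank is $r_2(\Gamma)=\min\{|U| : U\subseteq\Gamma,\ \langle U\rangle=\Gamma\}$, where $\langle U\rangle$ is the subsemigroup generated by $U$. *)

theory Defs
  imports "HOL-Library.FuncSet"
begin

datatype brandt = Theta  (\<open>\<vartheta>\<close>) | Elt nat nat

definition Brandt :: "nat \<Rightarrow> brandt set" where
  "Brandt n = {Elt i j | i j. i \<in> {1..n} \<and> j \<in> {1..n}} \<union> {\<vartheta>}"

fun brandt_add :: "brandt \<Rightarrow> brandt \<Rightarrow> brandt"  (infixl \<open>\<oplus>\<^sub>B\<close> 65) where
  "Elt i j \<oplus>\<^sub>B Elt k l = (if j = k then Elt i l else \<vartheta>)"
| "\<vartheta> \<oplus>\<^sub>B x = \<vartheta>"
| "x \<oplus>\<^sub>B \<vartheta> = \<vartheta>"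

text \<open>
  A map from \<open>Brandt n\<close> to itself is represented by its extensional representative (the value
  outside \<open>Brandt n\<close> is \<open>undefined\<close>), so that equality of representatives is equality of maps
  and cardinalities are correct.
\<close>

definition maps :: "nat \<Rightarrow> (brandt \<Rightarrow> brandt) set" where
  "maps n = Brandt n \<rightarrow>\<^sub>E Brandt n"

definition map_add :: "nat \<Rightarrow> (brandt \<Rightarrow> brandt) \<Rightarrow> (brandt \<Rightarrow> brandt) \<Rightarrow> (brandt \<Rightarrow> brandt)" where
  "map_add n f g = (\<lambda>x\<in>Brandt n. f x \<oplus>\<^sub>B g x)"

text \<open>
  Arguments are written on the left in this setting, \<open>x(fg) = (xf)g\<close>: the product of \<open>f\<close> and \<open>g\<close>
  applies \<open>f\<close> first, whereas \<^const>\<open>compose\<close> applies its last argument first.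
\<close>

definition map_comp_left ::
  "nat \<Rightarrow> (brandt \<Rightarrow> brandt) \<Rightarrow> (brandt \<Rightarrow> brandt) \<Rightarrow> (brandt \<Rightarrow> brandt)" where
  "map_comp_left n f g = compose (Brandt n) g f"

definition const_map :: "nat \<Rightarrow> brandt \<Rightarrow> (brandt \<Rightarrow> brandt)" where
  "const_map n c = (\<lambda>x\<in>Brandt n. c)"

definition endos :: "nat \<Rightarrow> (brandt \<Rightarrow> brandt) set" where
  "endos n = {g \<in> maps n. \<forall>x\<in>Brandt n. \<forall>y\<in>Brandt n. g (x \<oplus>\<^sub>B y) = g x \<oplus>\<^sub>B g y}"

definition Aff :: "nat \<Rightarrow> (brandt \<Rightarrow> brandt) set" where
  "Aff n = {map_add n g (const_map n c) | g c. g \<in> endos n \<and> c \<in> Brandt n}"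

inductive_set Aplus :: "nat \<Rightarrow> (brandt \<Rightarrow> brandt) set" for n :: nat where
  affine: "f \<in> Aff n \<Longrightarrow> f \<in> Aplus n"
| add: "f \<in> Aplus n \<Longrightarrow> g \<in> Aplus n \<Longrightarrow> map_add n f g \<in> Aplus n"
| comp: "f \<in> Aplus n \<Longrightarrow> g \<in> Aplus n \<Longrightarrow> map_comp_left n f g \<in> Aplus n"

lemma brandt_add_closed: "x \<in> Brandt n \<Longrightarrow> y \<in> Brandt n \<Longrightarrow> x \<oplus>\<^sub>B y \<in> Brandt n"
  by (cases x; cases y) (auto simp: Brandt_def)

lemma map_add_in_maps: "f \<in> maps n \<Longrightarrow> g \<in> maps n \<Longrightarrow> map_add n f g \<in> maps n"
  unfolding maps_def map_add_def by (auto intro!: brandt_add_closed)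

lemma map_comp_left_in_maps: "f \<in> maps n \<Longrightarrow> g \<in> maps n \<Longrightarrow> map_comp_left n f g \<in> maps n"
  unfolding maps_def map_comp_left_def compose_def by (auto simp: PiE_def)

lemma Aff_subset_maps: "Aff n \<subseteq> maps n"
proof
  fix f assume "f \<in> Aff n"
  then obtain g c where f: "f = map_add n g (const_map n c)" "g \<in> maps n" "c \<in> Brandt n"
    by (auto simp: Aff_def endos_def)
  moreover have "const_map n c \<in> maps n"
    using f(3) by (auto simp: const_map_def maps_def)
  ultimately show "f \<in> maps n"
    by (simp add: map_add_in_maps)
qed

lemma Aplus_subset_maps: "Aplus n \<subseteq> maps n"
proof
  fix f assume "f \<in> Aplus n"
  then show "f \<in> maps n"
    by induction (use Aff_subset_maps in \<open>auto intro: map_add_in_maps map_comp_left_in_maps\<close>)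
qed

inductive_set subsemigroup_gen :: "('a \<Rightarrow> 'a \<Rightarrow> 'a) \<Rightarrow> 'a set \<Rightarrow> 'a set"
  for mult :: "'a \<Rightarrow> 'a \<Rightarrow> 'a" and U :: "'a set" where
  gen: "u \<in> U \<Longrightarrow> u \<in> subsemigroup_gen mult U"
| mult: "x \<in> subsemigroup_gen mult U \<Longrightarrow> y \<in> subsemigroup_gen mult U \<Longrightarrow>
    mult x y \<in> subsemigroup_gen mult U"

text \<open>Meaningful only for a finite semigroup with carrier \<open>G\<close> and operation \<open>mult\<close>.\<close>

definition lower_rank :: "('a \<Rightarrow> 'a \<Rightarrow> 'a) \<Rightarrow> 'a set \<Rightarrow> nat" where
  "lower_rank mult G = Min {card U | U. U \<subseteq> G \<and> subsemigroup_gen mult U = G}"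

end

theory Submission
  imports Defs "HOL-Combinatorics.Permutations"
begin

text \<open>
  Every element of \<open>A\<^sup>+(B\<^sub>n)\<close> is a column map \<open>(p,q;\<sigma>)\<close>, a nonzero map supported at one point, or
  a constant map. For \<open>n \<ge> 2\<close> the complement of each of the following disjoint nonempty classes is
  closed under composition, so that a generating set has to meet all of them: the nonzero constants,
  the one-point maps and, for each \<open>p\<close>, the column maps supported on column \<open>p\<close>. For \<open>n = 2\<close>
  these are four classes, and four generators suffice since \<open>(1,2;(1 2))\<close> and \<open>(2,1;id)\<close>
  generate all column maps, which act transitively on the one-point maps and the nonzero constants.
\<close>

section \<open>The carrier and finiteness\<close>

lemma Theta_in_Brandt [simp]: "\<vartheta> \<in> Brandt n"
  by (simp add: Brandt_def)

lemma Elt_in_Brandt [simp]: "Elt i j \<in> Brandt n \<longleftrightarrow> i \<in> {1..n} \<and> j \<in> {1..n}"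
  by (auto simp: Brandt_def)

lemma brandt_add_Theta [simp]: "x \<oplus>\<^sub>B \<vartheta> = \<vartheta>"
  by (cases x) auto

lemma finite_Brandt: "finite (Brandt n)"
proof -
  have "Brandt n \<subseteq> insert \<vartheta> (case_prod Elt ` ({1..n} \<times> {1..n}))"
    by (auto simp: Brandt_def)
  then show ?thesis
    by (rule finite_subset) auto
qed

lemma finite_Aplus: "finite (Aplus n)"
  by (rule finite_subset [OF Aplus_subset_maps])
    (simp add: maps_def finite_Brandt finite_PiE)

section \<open>Column maps, one-point maps and constants\<close>

definition col_map :: "nat \<Rightarrow> nat \<Rightarrow> nat \<Rightarrow> (nat \<Rightarrow> nat) \<Rightarrow> brandt \<Rightarrow> brandt" where
  "col_map n p q \<sigma> = (\<lambda>x\<in>Brandt n. case x of \<vartheta> \<Rightarrow> \<vartheta> | Elt i j \<Rightarrow> if j = p then Elt (\<sigma> i) q else \<vartheta>)"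

definition point_map :: "nat \<Rightarrow> brandt \<Rightarrow> brandt \<Rightarrow> brandt \<Rightarrow> brandt" where
  "point_map n a b = (\<lambda>x\<in>Brandt n. if x = a then b else \<vartheta>)"

definition col_class :: "nat \<Rightarrow> nat \<Rightarrow> (brandt \<Rightarrow> brandt) set" where
  "col_class n p = {col_map n p q \<sigma> | q \<sigma>. q \<in> {1..n} \<and> \<sigma> permutes {1..n}}"

definition const_class :: "nat \<Rightarrow> (brandt \<Rightarrow> brandt) set" where
  "const_class n = const_map n ` (Brandt n - {\<vartheta>})"

definition point_class :: "nat \<Rightarrow> (brandt \<Rightarrow> brandt) set" where
  "point_class n = {point_map n a b | a b. a \<in> Brandt n - {\<vartheta>} \<and> b \<in> Brandt n - {\<vartheta>}}"

definition explicit :: "nat \<Rightarrow> (brandt \<Rightarrow> brandt) set" where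
  "explicit n = (\<Union>p\<in>{1..n}. col_class n p) \<union> const_map n ` Brandt n \<union> point_class n"

lemma point_map_Theta: "point_map n a \<vartheta> = const_map n \<vartheta>"
  by (auto simp: point_map_def const_map_def)

lemma explicit_col_map:
  "p \<in> {1..n} \<Longrightarrow> q \<in> {1..n} \<Longrightarrow> \<sigma> permutes {1..n} \<Longrightarrow> col_map n p q \<sigma> \<in> explicit n"
  by (auto simp: explicit_def col_class_def)

lemma explicit_const_map: "c \<in> Brandt n \<Longrightarrow> const_map n c \<in> explicit n"
  by (auto simp: explicit_def)

text \<open>Admitting \<open>b = \<vartheta>\<close>, where the map degenerates to the zero
  constant, lets composites and sums with one-point maps be treated without asking whether the new
  value vanishes.\<close>

lemma explicit_point_map:
  "a \<in> Brandt n - {\<vartheta>} \<Longrightarrow> b \<in> Brandt n \<Longrightarrow> point_map n a b \<in> explicit n"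
  by (cases "b = \<vartheta>") (auto simp: explicit_const_map point_map_Theta explicit_def point_class_def)

lemma explicit_cases [consumes 1, case_names col const point]:
  assumes "f \<in> explicit n"
  obtains (col) p q \<sigma> where "f = col_map n p q \<sigma>" "p \<in> {1..n}" "q \<in> {1..n}" "\<sigma> permutes {1..n}"
  | (const) c where "f = const_map n c" "c \<in> Brandt n"
  | (point) a b where "f = point_map n a b" "a \<in> Brandt n - {\<vartheta>}" "b \<in> Brandt n - {\<vartheta>}"
  using assms unfolding explicit_def col_class_def point_class_def by blast

lemma col_map_apply:
  "x \<in> Brandt n \<Longrightarrow>
    col_map n p q \<sigma> x = (case x of \<vartheta> \<Rightarrow> \<vartheta> | Elt i j \<Rightarrow> if j = p then Elt (\<sigma> i) q else \<vartheta>)"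
  by (simp add: col_map_def)

lemma col_map_at_Theta: "col_map n p q \<sigma> \<vartheta> = \<vartheta>"
  by (simp add: col_map_def)

lemma point_map_at_Theta: "a \<noteq> \<vartheta> \<Longrightarrow> point_map n a b \<vartheta> = \<vartheta>"
  by (simp add: point_map_def)

lemma col_map_in_Brandt:
  assumes "q \<in> {1..n}" "\<sigma> permutes {1..n}" "x \<in> Brandt n"
  shows "col_map n p q \<sigma> x \<in> Brandt n"
  using assms permutes_in_image [OF assms(2)] by (cases x) (auto simp: col_map_def)

lemma explicit_in_Brandt:
  assumes "f \<in> explicit n" "x \<in> Brandt n"
  shows "f x \<in> Brandt n"
  using assms
  by (cases rule: explicit_cases)
    (auto simp: col_map_in_Brandt const_map_def point_map_def)

section \<open>Composition table of the explicit maps\<close>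

lemma comp_const_left: "c \<in> Brandt n \<Longrightarrow> map_comp_left n (const_map n c) f = const_map n (f c)"
  by (auto simp: map_comp_left_def compose_def const_map_def)

lemma comp_const_right:
  "f \<in> explicit n \<Longrightarrow> map_comp_left n f (const_map n c) = const_map n c"
  by (auto simp: map_comp_left_def compose_def const_map_def explicit_in_Brandt)

lemma comp_point_left:
  "b \<in> Brandt n \<Longrightarrow> f \<vartheta> = \<vartheta> \<Longrightarrow> map_comp_left n (point_map n a b) f = point_map n a (f b)"
  by (auto simp: map_comp_left_def compose_def point_map_def)

text \<open>The nonzero values of the left factor lie in column \<open>q\<close> and are taken once
  each, so \<open>Elt k l\<close> can only be reached from \<open>Elt (inv \<sigma> k) p\<close>,
  and only if \<open>l = q\<close>.\<close>

lemma comp_col_point: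
  assumes "\<sigma> permutes {1..n}" "q \<in> {1..n}"
  shows "map_comp_left n (col_map n p q \<sigma>) (point_map n (Elt k l) b) =
    (if l = q then point_map n (Elt (inv \<sigma> k) p) b else const_map n \<vartheta>)"
proof
  fix x
  show "map_comp_left n (col_map n p q \<sigma>) (point_map n (Elt k l) b) x =
    (if l = q then point_map n (Elt (inv \<sigma> k) p) b else const_map n \<vartheta>) x"
    using assms permutes_in_image [OF assms(1)] permutes_inverses [OF assms(1)]
    by (cases x)
      (auto simp: map_comp_left_def compose_def col_map_def point_map_def const_map_def)
qed

text \<open>This is the multiplication of the Brandt semigroup over the symmetric group, with
  \<open>const_map n \<vartheta>\<close> as zero. The order in
  \<open>\<tau> \<circ> \<sigma>\<close> reflects that the left factor acts first.\<close>

lemma comp_col_col: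
  assumes "\<sigma> permutes {1..n}" "q \<in> {1..n}"
  shows "map_comp_left n (col_map n p q \<sigma>) (col_map n r s \<tau>) =
    (if q = r then col_map n p s (\<tau> \<circ> \<sigma>) else const_map n \<vartheta>)"
proof
  fix x
  show "map_comp_left n (col_map n p q \<sigma>) (col_map n r s \<tau>) x =
    (if q = r then col_map n p s (\<tau> \<circ> \<sigma>) else const_map n \<vartheta>) x"
    using assms permutes_in_image [OF assms(1)]
    by (cases x) (auto simp: map_comp_left_def compose_def col_map_def const_map_def)
qed

text \<open>The split on \<open>g\<close> comes first: a constant on the right absorbs
  \<open>f\<close>, and in the two other cases \<open>g\<close> fixes \<open>\<vartheta>\<close>, as
  \<open>comp_point_left\<close> requires.\<close>

lemma explicit_comp:
  assumes f: "f \<in> explicit n" and g: "g \<in> explicit n"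
  shows "map_comp_left n f g \<in> explicit n"
  using g
proof (cases rule: explicit_cases)
  case const
  then show ?thesis
    using f by (simp add: comp_const_right explicit_const_map)
next
  case g: (col r s \<tau>)
  show ?thesis
    using f
  proof (cases rule: explicit_cases)
    case (col p q \<sigma>)
    then show ?thesis
      using g by (auto simp: comp_col_col permutes_compose intro: explicit_col_map explicit_const_map)
  next
    case const
    then show ?thesis
      using assms by (auto simp: comp_const_left explicit_in_Brandt intro: explicit_const_map)
  next
    case point
    then show ?thesis
      using explicit_in_Brandt [OF assms(2)] g
      by (auto simp: comp_point_left col_map_at_Theta intro!: explicit_point_map)
  qed
next
  case g: (point a b)
  show ?thesis
    using f
  proof (cases rule: explicit_cases)
    case (col p q \<sigma>)
    obtain k l where a: "a = Elt k l"
      using g by (cases a) auto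
    have "inv \<sigma> k \<in> {1..n}"
      using g a permutes_in_image [OF permutes_inv [OF col(4)]] by auto
    then show ?thesis
      using g a col by (auto simp: comp_col_point intro!: explicit_point_map explicit_const_map)
  next
    case const
    then show ?thesis
      using assms by (auto simp: comp_const_left explicit_in_Brandt intro: explicit_const_map)
  next
    case point
    then show ?thesis
      using explicit_in_Brandt [OF assms(2)] g
      by (auto simp: comp_point_left point_map_at_Theta intro!: explicit_point_map)
  qed
qed

section \<open>Pointwise sums of explicit maps\<close>

lemma add_point_left: "map_add n (point_map n a b) f = point_map n a (b \<oplus>\<^sub>B f a)"
  by (auto simp: map_add_def point_map_def)

lemma add_point_right: "map_add n f (point_map n a b) = point_map n a (f a \<oplus>\<^sub>B b)"
  by (auto simp: map_add_def point_map_def)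

lemma add_const_const: "map_add n (const_map n c) (const_map n d) = const_map n (c \<oplus>\<^sub>B d)"
  by (auto simp: map_add_def const_map_def)

text \<open>On column \<open>p\<close> the sum is
  \<open>Elt k l \<oplus>\<^sub>B Elt (\<sigma> i) q\<close>, which survives only for
  \<open>\<sigma> i = l\<close>.\<close>

lemma add_const_col:
  assumes "\<sigma> permutes {1..n}"
  shows "map_add n (const_map n (Elt k l)) (col_map n p q \<sigma>) =
    point_map n (Elt (inv \<sigma> l) p) (Elt k q)"
proof
  fix x
  show "map_add n (const_map n (Elt k l)) (col_map n p q \<sigma>) x =
    point_map n (Elt (inv \<sigma> l) p) (Elt k q) x"
    using permutes_inverses [OF assms]
    by (cases x) (auto simp: map_add_def const_map_def col_map_def point_map_def)
qed

text \<open>All nonzero values end in the same index \<open>q\<close>, so a constant on the right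
  keeps the whole column or kills all of it.\<close>

lemma add_col_const:
  "map_add n (col_map n p q \<sigma>) (const_map n (Elt k l)) =
    (if q = k then col_map n p l \<sigma> else const_map n \<vartheta>)"
proof
  fix x
  show "map_add n (col_map n p q \<sigma>) (const_map n (Elt k l)) x =
    (if q = k then col_map n p l \<sigma> else const_map n \<vartheta>) x"
    by (cases x) (auto simp: map_add_def const_map_def col_map_def)
qed

text \<open>Different columns have disjoint supports. On a common column,
  \<open>Elt (\<sigma> i) q \<oplus>\<^sub>B Elt (\<tau> i) s\<close> survives only for
  \<open>\<tau> i = q\<close>.\<close>

lemma add_col_col:
  assumes "\<tau> permutes {1..n}"
  shows "map_add n (col_map n p q \<sigma>) (col_map n r s \<tau>) =
    (if p = r then point_map n (Elt (inv \<tau> q) p) (Elt (\<sigma> (inv \<tau> q)) s) else const_map n \<vartheta>)"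
proof
  fix x
  show "map_add n (col_map n p q \<sigma>) (col_map n r s \<tau>) x =
    (if p = r then point_map n (Elt (inv \<tau> q) p) (Elt (\<sigma> (inv \<tau> q)) s) else const_map n \<vartheta>) x"
    using permutes_inverses [OF assms]
    by (cases x) (auto simp: map_add_def const_map_def col_map_def point_map_def)
qed

lemma add_Theta_left: "map_add n (const_map n \<vartheta>) f = const_map n \<vartheta>"
  by (auto simp: map_add_def const_map_def)

lemma add_Theta_right: "map_add n f (const_map n \<vartheta>) = const_map n \<vartheta>"
  by (auto simp: map_add_def const_map_def)

lemma explicit_add:
  assumes f: "f \<in> explicit n" and g: "g \<in> explicit n"
  shows "map_add n f g \<in> explicit n"
  using f
proof (cases rule: explicit_cases)
  case (point a b)
  then show ?thesis
    using explicit_in_Brandt [OF g, of a]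
    by (auto simp: add_point_left intro!: explicit_point_map brandt_add_closed)
next
  case f': (col p q \<sigma>)
  show ?thesis
    using g
  proof (cases rule: explicit_cases)
    case (point a b)
    then show ?thesis
      using explicit_in_Brandt [OF f, of a]
      by (auto simp: add_point_right intro!: explicit_point_map brandt_add_closed)
  next
    case (const c)
    then show ?thesis
      using f' by (cases c)
        (auto simp: add_col_const add_Theta_right intro!: explicit_col_map explicit_const_map)
  next
    case (col r s \<tau>)
    have "inv \<tau> q \<in> {1..n}"
      using f' permutes_in_image [OF permutes_inv [OF col(4)]] by auto
    moreover from this have "\<sigma> (inv \<tau> q) \<in> {1..n}"
      using permutes_in_image [OF f'(4)] by blast
    ultimately show ?thesis
      using f' col by (auto simp: add_col_col intro!: explicit_point_map explicit_const_map)
  qed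
next
  case f': (const c)
  show ?thesis
    using g
  proof (cases rule: explicit_cases)
    case (point a b)
    then show ?thesis
      using explicit_in_Brandt [OF f, of a]
      by (auto simp: add_point_right intro!: explicit_point_map brandt_add_closed)
  next
    case (const d)
    then show ?thesis
      using f' by (auto simp: add_const_const intro!: explicit_const_map brandt_add_closed)
  next
    case (col r s \<tau>)
    show ?thesis
    proof (cases c)
      case Theta
      then show ?thesis
        using f' by (auto simp: add_Theta_left intro: explicit_const_map)
    next
      case (Elt k l)
      then have "inv \<tau> l \<in> {1..n}"
        using f' permutes_in_image [OF permutes_inv [OF col(4)]] by auto
      then show ?thesis
        using f' col Elt by (auto simp: add_const_col intro!: explicit_point_map)
    qed
  qed
qed

section \<open>Endomorphisms and affine maps\<close>

definition perm_endo :: "nat \<Rightarrow> (nat \<Rightarrow> nat) \<Rightarrow> brandt \<Rightarrow> brandt" where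
  "perm_endo n \<sigma> = (\<lambda>x\<in>Brandt n. case x of \<vartheta> \<Rightarrow> \<vartheta> | Elt i j \<Rightarrow> Elt (\<sigma> i) (\<sigma> j))"

lemma perm_endo_in_endos:
  assumes "\<sigma> permutes {1..n}"
  shows "perm_endo n \<sigma> \<in> endos n"
proof -
  have inj: "\<sigma> i = \<sigma> j \<longleftrightarrow> i = j" for i j
    using permutes_inj [OF assms] by (auto dest: injD)
  have mem: "perm_endo n \<sigma> x \<in> Brandt n" if "x \<in> Brandt n" for x
    using that permutes_in_image [OF assms] by (cases x) (auto simp: perm_endo_def)
  have "perm_endo n \<sigma> (x \<oplus>\<^sub>B y) = perm_endo n \<sigma> x \<oplus>\<^sub>B perm_endo n \<sigma> y"
    if "x \<in> Brandt n" "y \<in> Brandt n" for x y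
    using that by (cases x; cases y) (auto simp: perm_endo_def inj)
  moreover have "perm_endo n \<sigma> \<in> maps n"
    unfolding maps_def using mem by (auto simp: PiE_iff perm_endo_def)
  ultimately show ?thesis
    by (simp add: endos_def)
qed

text \<open>This is how column maps arise as affine maps: the constant on the right keeps exactly
  the \<open>Elt i j\<close> with \<open>\<sigma> j = k\<close>, a single column.\<close>

lemma add_perm_endo_const:
  assumes "\<sigma> permutes {1..n}"
  shows "map_add n (perm_endo n \<sigma>) (const_map n (Elt k l)) = col_map n (inv \<sigma> k) l \<sigma>"
proof
  fix x
  show "map_add n (perm_endo n \<sigma>) (const_map n (Elt k l)) x = col_map n (inv \<sigma> k) l \<sigma> x"
    using permutes_inverses [OF assms]
    by (cases x) (auto simp: map_add_def const_map_def col_map_def perm_endo_def)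
qed

text \<open>The image of \<open>\<vartheta>\<close> is a zero for the image of \<open>g\<close>; if
  it is nonzero, \<open>g\<close> is constant. If \<open>g\<close> fixes \<open>\<vartheta>\<close>,
  then killing one nonzero element kills all of them, and otherwise the action on the idempotents
  \<open>Elt i i\<close> yields the permutation.\<close>

lemma endos_cases:
  assumes g: "g \<in> endos n"
  obtains (const) c where "c \<in> Brandt n" "g = const_map n c"
  | (perm) \<sigma> where "\<sigma> permutes {1..n}" "g = perm_endo n \<sigma>"
proof -
  have hom: "g (x \<oplus>\<^sub>B y) = g x \<oplus>\<^sub>B g y" if "x \<in> Brandt n" "y \<in> Brandt n" for x y
    using g that by (auto simp: endos_def)
  have mem: "g x \<in> Brandt n" if "x \<in> Brandt n" for x
    using g that by (auto simp: endos_def maps_def)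
  have ext: "g x = undefined" if "x \<notin> Brandt n" for x
    using g that by (auto simp: endos_def maps_def)
  show ?thesis
  proof (cases "g \<vartheta>")
    case (Elt i j)
    have "g x = Elt i j" if "x \<in> Brandt n" for x
    proof -
      \<comment> \<open>Images of the equations saying that \<open>\<vartheta>\<close> is an
        idempotent zero; absorption by a nonzero element forces equality with it.\<close>
      have "g x \<oplus>\<^sub>B Elt i j = Elt i j" "Elt i j \<oplus>\<^sub>B g x = Elt i j" "Elt i j \<oplus>\<^sub>B Elt i j = Elt i j"
        using hom [OF that Theta_in_Brandt] hom [OF Theta_in_Brandt that]
          hom [OF Theta_in_Brandt Theta_in_Brandt]
        unfolding brandt_add_Theta brandt_add.simps(2) Elt by metis+
      then show ?thesis
        by (cases "g x") (auto split: if_splits)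
    qed
    then have "g = const_map n (Elt i j)"
      using ext by (auto simp: const_map_def fun_eq_iff)
    moreover have "Elt i j \<in> Brandt n"
      using mem [of \<vartheta>] unfolding Elt by simp
    ultimately show ?thesis
      using const by blast
  next
    case Theta
    show ?thesis
    proof (cases "\<exists>k\<in>{1..n}. \<exists>l\<in>{1..n}. g (Elt k l) = \<vartheta>")
      case True
      then obtain k l where kl: "k \<in> {1..n}" "l \<in> {1..n}" "g (Elt k l) = \<vartheta>"
        by blast
      \<comment> \<open>Every \<open>Elt i j\<close> factors through the killed element as
        \<open>(i,k) + (k,l) + (l,j)\<close>.\<close>
      have "g (Elt i j) = \<vartheta>" if "i \<in> {1..n}" "j \<in> {1..n}" for i j
        using hom [of "Elt i k" "Elt k j"] hom [of "Elt k l" "Elt l j"] that kl by simp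
      then have "g x = \<vartheta>" if "x \<in> Brandt n" for x
        using that Theta by (cases x) auto
      then have "g = const_map n \<vartheta>"
        using ext by (auto simp: const_map_def fun_eq_iff)
      then show ?thesis
        using const by force
    next
      case False
      \<comment> \<open>The image of an idempotent is idempotent, and the nonzero idempotents are
        diagonal.\<close>
      have "\<exists>s. g (Elt i i) = Elt s s" if "i \<in> {1..n}" for i
        using hom [of "Elt i i" "Elt i i"] that False
        by (cases "g (Elt i i)") (auto split: if_splits)
      then obtain s where s: "\<And>i. i \<in> {1..n} \<Longrightarrow> g (Elt i i) = Elt (s i) (s i)"
        by metis
      \<comment> \<open>Outside \<open>{1..n}\<close> the identity is chosen, as
        \<open>permutes\<close> demands.\<close>
      define \<sigma> where "\<sigma> i = (if i \<in> {1..n} then s i else i)" for i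
      have \<sigma>: "g (Elt i j) = Elt (\<sigma> i) (\<sigma> j)" if "i \<in> {1..n}" "j \<in> {1..n}" for i j
      proof -
        have "g (Elt i j) \<noteq> \<vartheta>"
          using that False by blast
        then obtain k l where kl: "g (Elt i j) = Elt k l"
          by (cases "g (Elt i j)") auto
        have ij: "Elt i i \<in> Brandt n" "Elt i j \<in> Brandt n" "Elt j j \<in> Brandt n"
          using that by auto
        \<comment> \<open>\<open>Elt i i\<close> is a left identity for \<open>Elt i j\<close>, so
          the image product is nonzero and the inner indices agree; the right identity
          \<open>Elt j j\<close> gives \<open>s j = l\<close>.\<close>
        have "s i = k"
          using hom [OF ij(1,2)] by (cases "s i = k") (simp_all add: kl s [OF that(1)])
        moreover have "s j = l"
          using hom [OF ij(2,3)] by (cases "s j = l") (simp_all add: kl s [OF that(2)])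
        ultimately show ?thesis
          using that by (simp add: kl \<sigma>_def)
      qed
      have "inj_on \<sigma> {1..n}"
      proof (rule inj_onI, rule ccontr)
        fix i j assume "i \<in> {1..n}" "j \<in> {1..n}" "\<sigma> i = \<sigma> j" "i \<noteq> j"
        \<comment> \<open>Two distinct diagonal idempotents sum to \<open>\<vartheta>\<close>,
          whereas their common image would be a nonzero idempotent.\<close>
        then show False
          using hom [of "Elt i i" "Elt j j"] \<sigma> Theta by simp
      qed
      moreover have "\<sigma> i \<in> {1..n}" if "i \<in> {1..n}" for i
        using mem [of "Elt i i"] \<sigma> [OF that that] that by auto
      ultimately have "\<sigma> ` {1..n} = {1..n}"
        by (intro endo_inj_surj) auto
      with \<open>inj_on \<sigma> {1..n}\<close> have "\<sigma> permutes {1..n}"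
        by (intro bij_imp_permutes bij_betw_imageI) (auto simp: \<sigma>_def)
      moreover have "g x = perm_endo n \<sigma> x" for x
        using \<sigma> Theta ext [of x] by (cases x) (auto simp: perm_endo_def)
      ultimately show ?thesis
        using perm by blast
    qed
  qed
qed

lemma Aff_subset_explicit: "Aff n \<subseteq> explicit n"
proof
  fix f assume "f \<in> Aff n"
  then obtain g c where f: "f = map_add n g (const_map n c)" and g: "g \<in> endos n"
    and c: "c \<in> Brandt n"
    by (auto simp: Aff_def)
  from g show "f \<in> explicit n"
  proof (cases rule: endos_cases)
    case (const d)
    then show ?thesis
      using f c by (simp add: explicit_add explicit_const_map)
  next
    case (perm \<sigma>)
    show ?thesis
    proof (cases c)
      case Theta
      then show ?thesis
        using f by (simp add: add_Theta_right explicit_const_map)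
    next
      case (Elt k l)
      then have "inv \<sigma> k \<in> {1..n}"
        using c permutes_in_image [OF permutes_inv [OF perm(1)]] by auto
      then show ?thesis
        using f c perm Elt by (auto simp: add_perm_endo_const intro: explicit_col_map)
    qed
  qed
qed

section \<open>The explicit maps lie in \<open>Aplus n\<close>\<close>

lemma col_map_in_Aplus:
  assumes "p \<in> {1..n}" "q \<in> {1..n}" "\<sigma> permutes {1..n}"
  shows "col_map n p q \<sigma> \<in> Aplus n"
proof -
  \<comment> \<open>The first index \<open>\<sigma> p\<close> is what makes column \<open>p\<close>
    the surviving one.\<close>
  have "col_map n p q \<sigma> = map_add n (perm_endo n \<sigma>) (const_map n (Elt (\<sigma> p) q))"
    using assms by (simp add: add_perm_endo_const permutes_inverses)
  moreover have "Elt (\<sigma> p) q \<in> Brandt n"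
    using assms permutes_in_image [OF assms(3)] by auto
  ultimately have "col_map n p q \<sigma> \<in> Aff n"
    using perm_endo_in_endos [OF assms(3)] unfolding Aff_def by blast
  then show ?thesis
    by (rule Aplus.affine)
qed

lemma const_map_in_Aplus:
  assumes "c \<in> Brandt n"
  shows "const_map n c \<in> Aplus n"
proof -
  \<comment> \<open>A constant map is an endomorphism when its value \<open>e\<close> is idempotent;
    a left identity of \<open>c\<close> then turns \<open>const_map n c\<close> into an affine
    map.\<close>
  obtain e where e: "e \<in> Brandt n" "e \<oplus>\<^sub>B e = e" "e \<oplus>\<^sub>B c = c"
  proof (cases c)
    case Theta
    then show ?thesis
      using that [of \<vartheta>] by simp
  next
    case (Elt i j)
    then show ?thesis
      using that [of "Elt i i"] assms by simp
  qed
  have "const_map n e \<in> endos n"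
    using e by (auto simp: endos_def maps_def const_map_def brandt_add_closed)
  moreover have "const_map n c = map_add n (const_map n e) (const_map n c)"
    using e by (simp add: add_const_const)
  ultimately have "const_map n c \<in> Aff n"
    using assms by (auto simp: Aff_def)
  then show ?thesis
    by (rule Aplus.affine)
qed

lemma point_map_in_Aplus:
  assumes "a \<in> Brandt n - {\<vartheta>}" "b \<in> Brandt n - {\<vartheta>}"
  shows "point_map n a b \<in> Aplus n"
proof -
  obtain i p k q where ab: "a = Elt i p" "b = Elt k q"
    using assms by (cases a; cases b) auto
  \<comment> \<open>The second index \<open>i\<close> of the constant selects row \<open>i\<close>
    of column \<open>p\<close>, and the first index \<open>k\<close> replaces that row in the
    value.\<close>
  have "point_map n a b = map_add n (const_map n (Elt k i)) (col_map n p q id)"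
    using ab by (simp add: add_const_col permutes_id)
  also have "\<dots> \<in> Aplus n"
    using assms ab
    by (intro Aplus.add const_map_in_Aplus col_map_in_Aplus) (auto simp: permutes_id)
  finally show ?thesis .
qed

theorem Aplus_eq_explicit: "Aplus n = explicit n"
proof
  show "Aplus n \<subseteq> explicit n"
  proof
    fix f assume "f \<in> Aplus n"
    then show "f \<in> explicit n"
      by induction (use Aff_subset_explicit in \<open>auto intro: explicit_add explicit_comp\<close>)
  qed
  show "explicit n \<subseteq> Aplus n"
  proof
    fix f assume "f \<in> explicit n"
    then show "f \<in> Aplus n"
      by (cases rule: explicit_cases)
        (auto intro: col_map_in_Aplus const_map_in_Aplus point_map_in_Aplus)
  qed
qed

section \<open>Prime classes and the lower bound\<close>

lemma generators_meet_class:
  assumes gen: "subsemigroup_gen m U = G"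
    and cl: "\<And>x y. x \<in> G \<Longrightarrow> y \<in> G \<Longrightarrow> m x y \<in> K \<Longrightarrow> x \<in> K \<or> y \<in> K"
    and K: "k \<in> K" "k \<in> G"
  obtains u where "u \<in> U" "u \<in> K"
proof -
  \<comment> \<open>By \<open>cl\<close> the complement of \<open>K\<close> in \<open>G\<close> is
    closed, so generators avoiding \<open>K\<close> never produce an element of
    \<open>K\<close>.\<close>
  have "x \<notin> K" if "U \<inter> K = {}" "x \<in> subsemigroup_gen m U" for x
    using that(2)
  proof induction
    case (gen u)
    then show ?case
      using that(1) by blast
  next
    case (mult x y)
    then show ?case
      using cl [of x y] gen by blast
  qed
  then show ?thesis
    using gen K that by blast
qed

text \<open>The nonzero constants are the explicit maps that move \<open>\<vartheta>\<close>, and a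
  composite of maps fixing \<open>\<vartheta>\<close> fixes it too.\<close>

lemma const_class_prime:
  assumes "f \<in> explicit n" "g \<in> explicit n" "map_comp_left n f g \<in> const_class n"
  shows "f \<in> const_class n \<or> g \<in> const_class n"
proof -
  have *: "h \<vartheta> = \<vartheta>" if "h \<in> explicit n" "h \<notin> const_class n" for h
    using that
    by (cases rule: explicit_cases)
      (auto simp: const_class_def col_map_def point_map_def const_map_def)
  have "map_comp_left n f g \<vartheta> \<noteq> \<vartheta>"
    using assms(3) by (auto simp: const_class_def const_map_def)
  then have "f \<vartheta> \<noteq> \<vartheta> \<or> g \<vartheta> \<noteq> \<vartheta>"
    by (auto simp: map_comp_left_def compose_def)
  then show ?thesis
    using * assms by blast
qed

lemma const_map_neq_point_map:
  assumes "a \<noteq> \<vartheta>" "a \<in> Brandt n" "b \<noteq> \<vartheta>"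
  shows "const_map n c \<noteq> point_map n a b"
proof
  assume "const_map n c = point_map n a b"
  from fun_cong [OF this, of \<vartheta>] fun_cong [OF this, of a] show False
    using assms by (auto simp: const_map_def point_map_def split: if_splits)
qed

lemma col_map_neq_const_map:
  assumes "p \<in> {1..n}"
  shows "col_map n p q \<sigma> \<noteq> const_map n c"
proof
  assume "col_map n p q \<sigma> = const_map n c"
  from fun_cong [OF this, of \<vartheta>] fun_cong [OF this, of "Elt p p"] show False
    using assms by (auto simp: const_map_def col_map_def)
qed

text \<open>A column has at least two points when \<open>2 \<le> n\<close>; for \<open>n = 1\<close>
  the two kinds of maps coincide.\<close>

lemma col_map_neq_point_map:
  assumes "2 \<le> n" "p \<in> {1..n}"
  shows "col_map n p q \<sigma> \<noteq> point_map n a b"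
proof
  assume eq: "col_map n p q \<sigma> = point_map n a b"
  have "Elt i p = a" if "i \<in> {1..n}" for i
    using fun_cong [OF eq, of "Elt i p"] that assms
    by (auto simp: point_map_def col_map_def split: if_splits)
  from this [of 1] this [of 2] show False
    using assms by auto
qed

lemma col_map_eq_col:
  assumes "p \<in> {1..n}" "col_map n p q \<sigma> = col_map n r s \<tau>"
  shows "p = r"
  using fun_cong [OF assms(2), of "Elt p p"] assms(1)
  by (auto simp: col_map_def split: if_splits)

text \<open>Without a one-point factor, a composite is a constant if one factor is, and otherwise a
  column map or the zero constant.\<close>

lemma point_class_prime:
  assumes n: "2 \<le> n" and f: "f \<in> explicit n" and g: "g \<in> explicit n"
    and fg: "map_comp_left n f g \<in> point_class n"
  shows "f \<in> point_class n \<or> g \<in> point_class n"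
proof (rule ccontr)
  assume neg: "\<not> ?thesis"
  have *: "h \<in> point_class n \<Longrightarrow> h \<noteq> const_map n c" for h c
    using const_map_neq_point_map by (fastforce simp: point_class_def)
  have **: "p \<in> {1..n} \<Longrightarrow> col_map n p q \<sigma> \<notin> point_class n" for p q \<sigma>
    using col_map_neq_point_map [OF n] by (fastforce simp: point_class_def)
  from g show False
  proof (cases rule: explicit_cases)
    case (const c)
    then show False
      using * [OF fg] comp_const_right [OF f] by auto
  next
    case (point a b)
    then show False
      using neg by (auto simp: point_class_def)
  next
    case g: (col r s \<tau>)
    from f show False
    proof (cases rule: explicit_cases)
      case (const c)
      then show False
        using * [OF fg] comp_const_left by auto
    next
      case (point a b)
      then show False
        using neg by (auto simp: point_class_def)
    next
      case (col p q \<sigma>)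
      then show False
        using g fg * [OF fg] ** by (auto simp: comp_col_col split: if_splits)
    qed
  qed
qed

text \<open>More than primeness holds: once \<open>g\<close> fixes \<open>\<vartheta>\<close>, the
  support of the composite lies in that of \<open>f\<close>, so the left factor itself belongs to
  the class.\<close>

lemma col_class_prime:
  assumes n: "2 \<le> n" and p: "p \<in> {1..n}" and f: "f \<in> explicit n" and g: "g \<in> explicit n"
    and fg: "map_comp_left n f g \<in> col_class n p"
  shows "f \<in> col_class n p"
proof -
  obtain q \<sigma> where fg: "map_comp_left n f g = col_map n p q \<sigma>"
    using fg by (auto simp: col_class_def)
  \<comment> \<open>Among explicit maps only constants can move \<open>\<vartheta>\<close>, and a
    constant \<open>g\<close> would make the composite constant.\<close>
  from g have g_Theta: "g \<vartheta> = \<vartheta>"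
  proof (cases rule: explicit_cases)
    case (const c)
    then show ?thesis
      using comp_const_right [OF f, of c] fg col_map_neq_const_map [OF p] by metis
  qed (auto simp: col_map_def point_map_def)
  from f show ?thesis
  proof (cases rule: explicit_cases)
    case (const c)
    then show ?thesis
      using comp_const_left fg col_map_neq_const_map [OF p] by metis
  next
    case (point a b)
    then have "col_map n p q \<sigma> = point_map n a (g b)"
      using comp_point_left [of b n g a] g_Theta fg by simp
    then show ?thesis
      using col_map_neq_point_map [OF n p] by blast
  next
    case (col r s \<tau>)
    have "map_comp_left n f g (Elt p p) \<noteq> \<vartheta>"
      using p by (simp add: fg col_map_def)
    then have "p = r"
      using p g_Theta col
      by (auto simp: map_comp_left_def compose_def col_map_def split: if_splits)
    then show ?thesis
      using col by (auto simp: col_class_def)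
  qed
qed

lemma card_generators_ge:
  assumes gen: "subsemigroup_gen (map_comp_left n) U = Aplus n" and n: "2 \<le> n"
  shows "n + 2 \<le> card U"
proof -
  have gen': "subsemigroup_gen (map_comp_left n) U = explicit n"
    using gen Aplus_eq_explicit by simp
  \<comment> \<open>Finiteness matters for the bound, since \<open>card\<close> is 0 on infinite
    sets.\<close>
  have finU: "finite U"
    using finite_Aplus subsemigroup_gen.gen [of _ U "map_comp_left n"] gen
    by (metis finite_subset subsetI)
  have one: "1 \<in> {1..n}"
    using n by simp
  have "\<exists>u\<in>U. u \<in> col_class n p" if "p \<in> {1..n}" for p
  proof (rule generators_meet_class [OF gen', of "col_class n p"])
    show "col_map n p p id \<in> col_class n p"
      using that permutes_id unfolding col_class_def by blast
    show "col_map n p p id \<in> explicit n"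
      using that permutes_id by (intro explicit_col_map) auto
  qed (use col_class_prime [OF n that] in blast)+
  then obtain u where u: "\<And>p. p \<in> {1..n} \<Longrightarrow> u p \<in> U \<and> u p \<in> col_class n p"
    by metis
  obtain v where v: "v \<in> U" "v \<in> const_class n"
  proof (rule generators_meet_class [OF gen', of "const_class n"])
    show "const_map n (Elt 1 1) \<in> const_class n"
      using one by (auto simp: const_class_def)
    show "const_map n (Elt 1 1) \<in> explicit n"
      using one by (intro explicit_const_map) auto
  qed (use const_class_prime in blast)+
  obtain w where w: "w \<in> U" "w \<in> point_class n"
  proof (rule generators_meet_class [OF gen', of "point_class n"])
    show "point_map n (Elt 1 1) (Elt 1 1) \<in> point_class n"
      using one by (fastforce simp: point_class_def)
    show "point_map n (Elt 1 1) (Elt 1 1) \<in> explicit n"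
      using one by (intro explicit_point_map) auto
  qed (use point_class_prime [OF n] in blast)+
  have u_col: "\<exists>q \<sigma>. u p = col_map n p q \<sigma>" if "p \<in> {1..n}" for p
    using u [OF that] unfolding col_class_def by blast
  \<comment> \<open>The classes are disjoint, so the chosen representatives are \<open>n + 2\<close>
    different generators.\<close>
  have inj: "inj_on u {1..n}"
  proof (rule inj_onI)
    fix p r assume pr: "p \<in> {1..n}" "r \<in> {1..n}" "u p = u r"
    then show "p = r"
      using u_col col_map_eq_col by metis
  qed
  have "v \<noteq> w"
    using v w const_map_neq_point_map by (fastforce simp: const_class_def point_class_def)
  moreover have "v \<notin> u ` {1..n}"
  proof -
    obtain c where "v = const_map n c"
      using v unfolding const_class_def by blast
    then show ?thesis
      using u_col col_map_neq_const_map by (metis imageE)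
  qed
  moreover have "w \<notin> u ` {1..n}"
  proof -
    obtain a b where "w = point_map n a b"
      using w unfolding point_class_def by blast
    then show ?thesis
      using u_col col_map_neq_point_map [OF n] by (metis imageE)
  qed
  moreover have "card (u ` {1..n}) = n"
    using inj by (simp add: card_image)
  ultimately have "card (insert v (insert w (u ` {1..n}))) = n + 2"
    by simp
  moreover have "insert v (insert w (u ` {1..n})) \<subseteq> U"
    using u v w by blast
  ultimately show ?thesis
    using card_mono [OF finU] by metis
qed

section \<open>Four generators for \<open>n = 2\<close>\<close>

definition four_gens :: "(brandt \<Rightarrow> brandt) set" where
  "four_gens = {col_map 2 1 2 (transpose 1 2), col_map 2 2 1 id,
     point_map 2 (Elt 1 1) (Elt 1 1), const_map 2 (Elt 1 1)}"

lemma permutes_12: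
  assumes "\<sigma> permutes {1..2::nat}"
  shows "\<sigma> = id \<or> \<sigma> = transpose 1 2"
proof -
  have "{1..2::nat} = {1, 2}"
    by auto
  then show ?thesis
    using assms permutes_doubleton_iff [of \<sigma> 1 2] by simp
qed

text \<open>The two column generators form a loop between the columns that carries the
  transposition, hence all of the symmetric group on two points. With identities on both, only
  identities would arise.\<close>

lemma four_gens_generate: "subsemigroup_gen (map_comp_left 2) four_gens = Aplus 2"
proof
  let ?G = "subsemigroup_gen (map_comp_left 2) four_gens"
  let ?t = "transpose 1 2 :: nat \<Rightarrow> nat"
  have t: "?t permutes {1..2}"
    by (rule permutes_swap_id) auto
  have i: "id permutes {1..2::nat}"
    by (rule permutes_id)
  have one_two: "p \<in> {1..2} \<longleftrightarrow> p = 1 \<or> p = 2" for p :: nat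
    by auto
  show "?G \<subseteq> Aplus 2"
  proof
    fix f assume "f \<in> ?G"
    then show "f \<in> Aplus 2"
    proof induction
      case (gen u)
      then show ?case
        using t i col_map_in_Aplus [of _ 2] const_map_in_Aplus [of _ 2] point_map_in_Aplus [of _ 2]
        by (auto simp: four_gens_def)
    qed (rule Aplus.comp)
  qed
  note mult = subsemigroup_gen.mult [of _ "map_comp_left 2" four_gens]
  have gens: "f \<in> ?G" if "f \<in> four_gens" for f
    using that by (rule subsemigroup_gen.gen)
  have col_mult: "col_map 2 p s (\<tau> \<circ> \<sigma>) \<in> ?G"
    if "col_map 2 p q \<sigma> \<in> ?G" "col_map 2 q s \<tau> \<in> ?G" "\<sigma> permutes {1..2}" "q \<in> {1..2}"
    for p q s \<sigma> \<tau>
    using mult [OF that(1,2)] that by (simp add: comp_col_col)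
  have c12t: "col_map 2 1 2 ?t \<in> ?G" and c21i: "col_map 2 2 1 id \<in> ?G"
    by (rule gens; simp add: four_gens_def)+
  have c11t: "col_map 2 1 1 ?t \<in> ?G"
    using col_mult [OF c12t c21i] t by simp
  have c22t: "col_map 2 2 2 ?t \<in> ?G"
    using col_mult [OF c21i c12t] i by simp
  have c11i: "col_map 2 1 1 id \<in> ?G"
    using col_mult [OF c11t c11t] t by simp
  have c22i: "col_map 2 2 2 id \<in> ?G"
    using col_mult [OF c22t c22t] t by simp
  have c12i: "col_map 2 1 2 id \<in> ?G"
    using col_mult [OF c11t c12t] t by simp
  have c21t: "col_map 2 2 1 ?t \<in> ?G"
    using col_mult [OF c21i c11t] i by simp
  have col: "col_map 2 p q \<sigma> \<in> ?G"
    if "p \<in> {1..2}" "q \<in> {1..2}" "\<sigma> permutes {1..2}" for p q \<sigma>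
    using that(1,2) permutes_12 [OF that(3)] c11i c11t c12i c12t c21i c21t c22i c22t
    unfolding one_two by blast
  have trans: "\<exists>\<sigma>. \<sigma> permutes {1..2} \<and> \<sigma> k = k'" if "k \<in> {1..2}" "k' \<in> {1..2}" for k k' :: nat
    using that by (intro exI [of _ "transpose k k'"]) (auto intro: permutes_swap_id)
  \<comment> \<open>The inner indices 2 and 1 do not match, so this square is zero.\<close>
  have theta: "const_map 2 \<vartheta> \<in> ?G"
    using mult [OF c12t c12t] t by (simp add: comp_col_col)
  have const: "const_map 2 c \<in> ?G" if c: "c \<in> Brandt 2" for c
  proof (cases c)
    case Theta
    then show ?thesis
      using theta by simp
  next
    case (Elt k l)
    then obtain \<sigma> where \<sigma>: "\<sigma> permutes {1..2}" "\<sigma> 1 = k"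
      using trans [of 1 k] c by auto
    have "const_map 2 (Elt 1 1) \<in> ?G"
      by (rule gens; simp add: four_gens_def)
    \<comment> \<open>The column map sends the value \<open>Elt 1 1\<close> to
      \<open>Elt (\<sigma> 1) l\<close>.\<close>
    from mult [OF this col [of 1 l \<sigma>]] show ?thesis
      using \<sigma> c Elt by (simp add: comp_const_left col_map_apply)
  qed
  have point_mem: "point_map 2 (Elt k p) (Elt m q) \<in> ?G"
    if kp: "k \<in> {1..2}" "p \<in> {1..2}" and mq: "m \<in> {1..2}" "q \<in> {1..2}" for k p m q
  proof -
    \<comment> \<open>Multiplying by \<open>col_map 2 p 1 \<sigma>\<close> on the left moves the
      support from \<open>Elt 1 1\<close> to \<open>Elt k p\<close>; multiplying by
      \<open>col_map 2 1 q \<tau>\<close> on the right moves the value to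
      \<open>Elt m q\<close>.\<close>
    obtain \<sigma> where \<sigma>: "\<sigma> permutes {1..2}" "\<sigma> k = 1"
      using trans [of k 1] kp by auto
    obtain \<tau> where \<tau>: "\<tau> permutes {1..2}" "\<tau> 1 = m"
      using trans [of 1 m] mq by auto
    have "inv \<sigma> 1 = k"
      using \<sigma> permutes_inverses(2) by metis
    moreover have "point_map 2 (Elt 1 1) (Elt 1 1) \<in> ?G"
      by (rule gens; simp add: four_gens_def)
    ultimately have "point_map 2 (Elt k p) (Elt 1 1) \<in> ?G"
      using mult [OF col [of p 1 \<sigma>]] \<sigma> kp by (force simp: comp_col_point)
    from mult [OF this col [of 1 q \<tau>]] show ?thesis
      using \<tau> mq by (simp add: comp_point_left col_map_apply)
  qed
  show "Aplus 2 \<subseteq> ?G"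
  proof
    fix f assume "f \<in> Aplus 2"
    then have "f \<in> explicit 2"
      by (simp add: Aplus_eq_explicit)
    then show "f \<in> ?G"
    proof (cases rule: explicit_cases)
      case (point a b)
      then show ?thesis
        using point_mem by (cases a; cases b) auto
    qed (auto intro: col const)
  qed
qed

theorem theorem3p6:
  shows "lower_rank (map_comp_left 2) (Aplus 2) = 4"
proof -
  let ?R = "{card U | U. U \<subseteq> Aplus 2 \<and> subsemigroup_gen (map_comp_left 2) U = Aplus 2}"
  have ge: "4 \<le> card U" if "subsemigroup_gen (map_comp_left 2) U = Aplus 2" for U
    using card_generators_ge [OF that] by simp
  \<comment> \<open>The reverse inequality comes from the lower bound, which spares a proof that the
    four maps are distinct.\<close>
  have "card four_gens \<le> 4"
    unfolding four_gens_def by (simp add: card_insert_le_m1)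
  then have "card four_gens = 4"
    using ge [OF four_gens_generate] by simp
  moreover have "four_gens \<subseteq> Aplus 2"
    using subsemigroup_gen.gen [of _ four_gens "map_comp_left 2"] four_gens_generate by blast
  ultimately have "4 \<in> ?R"
    using four_gens_generate by force
  \<comment> \<open>\<open>Min\<close> is characterised only on finite sets; here each
    \<open>U\<close> is a subset of the finite \<open>Aplus 2\<close>.\<close>
  moreover have "finite ?R"
    using finite_Aplus [of 2] by simp
  ultimately have "Min ?R = 4"
    using ge by (intro Min_eqI) auto
  then show ?thesis
    by (simp add: lower_rank_def)
qed

end
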